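(* Let $(Y,d)$ be a metric space, $\alpha<1$ and $N\in\mathbb{N}$. Then $J_\alpha$ is an ideal quasimetric on $\mathcal{A}_N(Y)$ with $\sigma_\infty(J_\alpha)\le N^{2(1-\alpha)}$.
   Context: A quasimetric on a nonempty set $X$ is a function $J:X\times X\to\mathbb{R}$ such that for all $x,y,z\in X$: (1) $J(x,y)\ge 0$; (2) $J(x,y)=0$ iff $x=y$; (3) $J(x,y)=J(y,x)$; (4) $J(x,y)\le\sigma[J(x,z)+J(z,y)]$ for some constant $\sigma\ge1$ independent of $x,y,z$. For each $n$, $\sigma_n(J)$ is the smallest number $\sigma_n\ge1$ with $J(x_1,x_{n+1})\le\sigma_n\sum_{i=1}^nJ(x_i,x_{i+1})$ for all $x_1,\dots,x_{n+1}\in X$, and $\sigma_\infty(J)=\lim_n\sigma_n(J)\in[1,\infty]$ (the sequence is nondecreasing). $J$ is ideal if $\sigma_\infty(J)<\infty$. $\mathcal{A}_N(Y)$ is the set of atomic probability measures $\sum_{i=1}^m a_i\delta_{x_i}$ on $Y$ with $m\le N$, $x_i\in Y$ distinct, $a_i>0$, $\sum_i a_i=1$ ($\delta_x$ is the Dirac measure at $x$). For $\mathbf{a}=\sum_{i=1}^m a_i\delta_{x_i}$ and $\mathbf{b}=\sum_{j=1}^n b_j\delta_{y_j}$, $Plan(\mathbf a,\mathbf b)$ is the set of transport plans $\gamma=\sum_{i=1}^m\sum_{j=1}^n\gamma_{ij}\delta_{(x_i,y_j)}$ with $\gamma_{ij}\ge0$, $\sum_{i}\gamma_{ij}=b_j$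 and $\sum_{j}\gamma_{ij}=a_i$ for all $i,j$. Put $H_\alpha(\gamma)=\sum_{i,j}(\gamma_{ij})^\alpha d(x_i,y_j)$, where terms with $\gamma_{ij}=0$ are taken to be $0$, and $J_\alpha(\mathbf a,\mathbf b)=\min\{H_\alpha(\gamma):\gamma\in Plan(\mathbf a,\mathbf b)\}$.
   Formalization: The formal theorem assumes 0 ≤ α < 1 and N ≥ 1; for α < 0, N ≥ 2 and Y with at least two points the claim fails, since J_α(eδ_p+(1-e)δ_q, δ_q) → ∞ as e → 0 while the path through δ_p stays bounded, and for N = 0 the set A_N(Y) is empty. *)

theory Defs
  imports "HOL-Probability.Probability"
begin

definition quasimetric_on :: "'b set \<Rightarrow> ('b \<Rightarrow> 'b \<Rightarrow> real) \<Rightarrow> bool" where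
  "quasimetric_on X J \<longleftrightarrow>
     X \<noteq> {} \<and>
     (\<forall>x\<in>X. \<forall>y\<in>X. 0 \<le> J x y) \<and>
     (\<forall>x\<in>X. \<forall>y\<in>X. J x y = 0 \<longleftrightarrow> x = y) \<and>
     (\<forall>x\<in>X. \<forall>y\<in>X. J x y = J y x) \<and>
     (\<exists>\<sigma>\<ge>1. \<forall>x\<in>X. \<forall>y\<in>X. \<forall>z\<in>X. J x y \<le> \<sigma> * (J x z + J z y))"

(* On a quasimetric the least constant exists for every n (by iterating the relaxed triangle
   inequality), so LEAST, which on the reals is a definite description, denotes it.
   The index n = 0 is harmless: it gives 1 and does not affect the limit below. *)
definition sigma_const :: "'b set \<Rightarrow> ('b \<Rightarrow> 'b \<Rightarrow> real) \<Rightarrow> nat \<Rightarrow> real" where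
  "sigma_const X J n =
     (LEAST \<sigma>::real. 1 \<le> \<sigma> \<and>
        (\<forall>x::nat \<Rightarrow> 'b. (\<forall>i\<in>{1..n+1}. x i \<in> X) \<longrightarrow>
           J (x 1) (x (n+1)) \<le> \<sigma> * (\<Sum>i=1..n. J (x i) (x (i+1)))))"

definition sigma_infinity :: "'b set \<Rightarrow> ('b \<Rightarrow> 'b \<Rightarrow> real) \<Rightarrow> ereal" where
  "sigma_infinity X J = lim (\<lambda>n. ereal (sigma_const X J n))"

definition ideal_quasimetric_on :: "'b set \<Rightarrow> ('b \<Rightarrow> 'b \<Rightarrow> real) \<Rightarrow> bool" where
  "ideal_quasimetric_on X J \<longleftrightarrow> quasimetric_on X J \<and> sigma_infinity X J < \<infinity>"

(* The atomic probability measure with distinct atoms x_i and weights a_i > 0 is the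
   probability mass function a with support {x_1, ..., x_m} and pmf a x_i = a_i. *)
definition atomic_measures :: "nat \<Rightarrow> 'a pmf set" where
  "atomic_measures N = {a. finite (set_pmf a) \<and> card (set_pmf a) \<le> N}"

definition transport_plans :: "'a pmf \<Rightarrow> 'a pmf \<Rightarrow> ('a \<times> 'a) pmf set" where
  "transport_plans a b =
     {\<gamma>. set_pmf \<gamma> \<subseteq> set_pmf a \<times> set_pmf b \<and>
          (\<forall>y\<in>set_pmf b. (\<Sum>x\<in>set_pmf a. pmf \<gamma> (x, y)) = pmf b y) \<and>
          (\<forall>x\<in>set_pmf a. (\<Sum>y\<in>set_pmf b. pmf \<gamma> (x, y)) = pmf a x)}"

(* The sum runs over the support of the plan: pairs carrying no mass contribute 0,
   whatever the exponent (also for the exponent 0). *)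
definition plan_cost :: "real \<Rightarrow> ('a::metric_space \<times> 'a) pmf \<Rightarrow> real" where
  "plan_cost \<alpha> \<gamma> = (\<Sum>(x, y)\<in>set_pmf \<gamma>. pmf \<gamma> (x, y) powr \<alpha> * dist x y)"

(* LEAST rather than Inf: the value is an attained minimum. *)
definition transport_cost :: "real \<Rightarrow> 'a::metric_space pmf \<Rightarrow> 'a pmf \<Rightarrow> real" where
  "transport_cost \<alpha> a b = (LEAST c. c \<in> plan_cost \<alpha> ` transport_plans a b)"

end

theory Submission imports Defs begin

text \<open>Glue optimal plans along a chain of measures into the law of a random path
  \<open>w\<^sub>0, \<dots>, w\<^sub>n\<close>, and use the law \<open>\<gamma>\<close> of its pair of endpoints \<open>e\<close> as a competitor. The triangle
  inequality along paths bounds its cost by the sum over the steps \<open>s\<close> of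
  \<open>\<gamma>(e) powr (\<alpha> - 1) * P(e, s) * d(s)\<close>, and \<open>P(e, s) \<le> \<gamma>(e)\<close> turns each term into at most
  \<open>P(e, s) powr \<alpha> * d(s)\<close>. Since at most \<open>N * N\<close> endpoint pairs occur, concavity of the power
  function bounds the sum over \<open>e\<close> by \<open>(N * N) powr (1 - \<alpha>) * P(s) powr \<alpha> * d(s)\<close>.\<close>

section \<open>Finitely supported measures and their couplings\<close>

lemma pmf_map_finite:
  assumes "finite (set_pmf p)"
  shows "pmf (map_pmf f p) y = (\<Sum>w | w \<in> set_pmf p \<and> f w = y. pmf p w)"
proof -
  have "pmf (map_pmf f p) y = measure p (f -` {y} \<inter> set_pmf p)"
    by (simp add: pmf_map measure_Int_set_pmf)
  also have "f -` {y} \<inter> set_pmf p = {w. w \<in> set_pmf p \<and> f w = y}"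
    by auto
  finally show ?thesis
    using assms by (simp add: measure_measure_pmf_finite)
qed

lemma sum_map_pmf:
  fixes h :: "'b \<Rightarrow> real"
  assumes "finite (set_pmf p)"
  shows "(\<Sum>y\<in>set_pmf (map_pmf f p). pmf (map_pmf f p) y * h y)
       = (\<Sum>w\<in>set_pmf p. pmf p w * h (f w))"
proof -
  have "(\<Sum>w\<in>set_pmf p. pmf p w * h (f w)) = measure_pmf.expectation p (\<lambda>w. h (f w))"
    using assms by (subst integral_measure_pmf_real[where A = "set_pmf p"]) (auto simp: mult.commute)
  also have "\<dots> = measure_pmf.expectation (map_pmf f p) h"
    by simp
  also have "\<dots> = (\<Sum>y\<in>set_pmf (map_pmf f p). pmf (map_pmf f p) y * h y)"
    using assms by (subst integral_measure_pmf_real[where A = "set_pmf (map_pmf f p)"])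
      (auto simp: mult.commute)
  finally show ?thesis ..
qed

lemma pmf_map_fst_sum:
  assumes "finite A" "finite B" "set_pmf g \<subseteq> A \<times> B"
  shows "pmf (map_pmf fst g) x = (\<Sum>y\<in>B. pmf g (x, y))"
proof -
  have "finite (set_pmf g)"
    using assms finite_subset by blast
  then have "pmf (map_pmf fst g) x = (\<Sum>w | w \<in> set_pmf g \<and> fst w = x. pmf g w)"
    by (rule pmf_map_finite)
  also have "\<dots> = (\<Sum>w\<in>Pair x ` B. pmf g w)"
    using assms by (intro sum.mono_neutral_left) (auto simp: set_pmf_eq)
  also have "\<dots> = (\<Sum>y\<in>B. pmf g (x, y))"
    by (subst sum.reindex) (auto simp: inj_on_def)
  finally show ?thesis .
qed

lemma pmf_map_snd_sum:
  assumes "finite A" "finite B" "set_pmf g \<subseteq> A \<times> B"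
  shows "pmf (map_pmf snd g) y = (\<Sum>x\<in>A. pmf g (x, y))"
proof -
  have "finite (set_pmf g)"
    using assms finite_subset by blast
  then have "pmf (map_pmf snd g) y = (\<Sum>w | w \<in> set_pmf g \<and> snd w = y. pmf g w)"
    by (rule pmf_map_finite)
  also have "\<dots> = (\<Sum>w\<in>(\<lambda>x. (x, y)) ` A. pmf g w)"
    using assms by (intro sum.mono_neutral_left) (auto simp: set_pmf_eq)
  also have "\<dots> = (\<Sum>x\<in>A. pmf g (x, y))"
    by (subst sum.reindex) (auto simp: inj_on_def)
  finally show ?thesis .
qed

text \<open>Replaces row and column sums by equations between marginals, so that plans can be built
  and transformed with \<open>map_pmf\<close>. The support inclusion follows from the
  marginals.\<close>

lemma transport_plans_iff:
  assumes "finite (set_pmf a)" "finite (set_pmf b)"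
  shows "g \<in> transport_plans a b \<longleftrightarrow> map_pmf fst g = a \<and> map_pmf snd g = b"
proof
  assume g: "g \<in> transport_plans a b"
  then have sub: "set_pmf g \<subseteq> set_pmf a \<times> set_pmf b"
    by (simp add: transport_plans_def)
  have "pmf (map_pmf fst g) x = pmf a x" for x
  proof (cases "x \<in> set_pmf a")
    case True
    then show ?thesis
      using g pmf_map_fst_sum[OF assms sub] by (simp add: transport_plans_def)
  next
    \<comment> \<open>The definition of plans constrains row sums only on \<open>set_pmf a\<close>;
      elsewhere the support inclusion makes both masses vanish.\<close>
    case False
    then have "x \<notin> set_pmf (map_pmf fst g)" using sub by auto
    with False show ?thesis by (simp add: set_pmf_eq)
  qed
  moreover have "pmf (map_pmf snd g) y = pmf b y" for y
  proof (cases "y \<in> set_pmf b")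
    case True
    then show ?thesis
      using g pmf_map_snd_sum[OF assms sub] by (simp add: transport_plans_def)
  next
    case False
    then have "y \<notin> set_pmf (map_pmf snd g)" using sub by auto
    with False show ?thesis by (simp add: set_pmf_eq)
  qed
  ultimately show "map_pmf fst g = a \<and> map_pmf snd g = b"
    by (auto intro: pmf_eqI)
next
  assume g: "map_pmf fst g = a \<and> map_pmf snd g = b"
  then have "set_pmf a = fst ` set_pmf g" "set_pmf b = snd ` set_pmf g"
    by (metis pmf.set_map)+
  then have sub: "set_pmf g \<subseteq> set_pmf a \<times> set_pmf b"
    by (simp add: subset_fst_snd)
  show "g \<in> transport_plans a b"
    using sub g pmf_map_fst_sum[OF assms sub] pmf_map_snd_sum[OF assms sub]
    by (simp add: transport_plans_def)
qed

lemma finite_set_transport_plan: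
  assumes "g \<in> transport_plans a b" "finite (set_pmf a)" "finite (set_pmf b)"
  shows "finite (set_pmf g)"
  using assms finite_subset[of "set_pmf g" "set_pmf a \<times> set_pmf b"]
  by (auto simp: transport_plans_def)

text \<open>The independent coupling witnesses that the set over which costs are minimized is
  nonempty.\<close>

lemma pair_pmf_transport_plan:
  assumes "finite (set_pmf a)" "finite (set_pmf b)"
  shows "pair_pmf a b \<in> transport_plans a b"
  using assms by (simp add: transport_plans_iff map_fst_pair_pmf map_snd_pair_pmf)

text \<open>Consecutive plans share a marginal, so a random path can be extended one point at a
  time. Paths are total functions, but only the coordinates up to \<open>n\<close> are
  constrained.\<close>

lemma glue_transport_plans:
  fixes \<mu> :: "nat \<Rightarrow> 'a pmf" and g :: "nat \<Rightarrow> ('a \<times> 'a) pmf"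
  assumes "\<And>i. i \<le> n \<Longrightarrow> finite (set_pmf (\<mu> i))"
    and "\<And>i. i < n \<Longrightarrow> map_pmf fst (g i) = \<mu> i"
    and "\<And>i. i < n \<Longrightarrow> map_pmf snd (g i) = \<mu> (Suc i)"
  shows "\<exists>P :: (nat \<Rightarrow> 'a) pmf. finite (set_pmf P) \<and>
    (\<forall>i\<le>n. map_pmf (\<lambda>w. w i) P = \<mu> i) \<and>
    (\<forall>i<n. map_pmf (\<lambda>w. (w i, w (Suc i))) P = g i)"
  using assms
proof (induction n)
  case 0
  show ?case
    using 0 by (intro exI[of _ "map_pmf (\<lambda>x _. x) (\<mu> 0)"]) (auto simp: pmf.map_comp o_def)
next
  case (Suc n)
  have "\<exists>P :: (nat \<Rightarrow> 'a) pmf. finite (set_pmf P) \<and>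
    (\<forall>i\<le>n. map_pmf (\<lambda>w. w i) P = \<mu> i) \<and>
    (\<forall>i<n. map_pmf (\<lambda>w. (w i, w (Suc i))) P = g i)"
    by (rule Suc.IH) (simp_all add: Suc.prems)
  then obtain P :: "(nat \<Rightarrow> 'a) pmf" where P: "finite (set_pmf P)"
    "\<And>i. i \<le> n \<Longrightarrow> map_pmf (\<lambda>w. w i) P = \<mu> i"
    "\<And>i. i < n \<Longrightarrow> map_pmf (\<lambda>w. (w i, w (Suc i))) P = g i"
    by blast
  \<comment> \<open>Equality of the shared marginals, read through \<open>rel_pmf\<close>, yields a
    coupling \<open>Q\<close> of \<open>P\<close> with \<open>g n\<close> in which the path ends
    where the next transport pair begins. This takes the place of conditional probabilities.\<close>
  have "rel_pmf (=) (map_pmf (\<lambda>w. w n) P) (map_pmf fst (g n))"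
    using P(2)[of n] Suc.prems(2)[of n] by (simp add: pmf.rel_eq)
  then have "rel_pmf (\<lambda>w q. w n = fst q) P (g n)"
    by (simp add: pmf.rel_map)
  then obtain Q where Q: "\<And>w q. (w, q) \<in> set_pmf Q \<Longrightarrow> w n = fst q"
    "map_pmf fst Q = P" "map_pmf snd Q = g n"
    by (elim rel_pmf.cases) blast
  define R where "R = map_pmf (\<lambda>(w, q). w(Suc n := snd q)) Q"
  have gn: "set_pmf (g n) \<subseteq> set_pmf (\<mu> n) \<times> set_pmf (\<mu> (Suc n))"
    unfolding Suc.prems(2,3)[of n, OF lessI, symmetric] by force
  have fin_gn: "finite (set_pmf (g n))"
    using gn Suc.prems(1)[of n] Suc.prems(1)[of "Suc n"] by (auto intro: finite_subset)
  have "set_pmf Q \<subseteq> set_pmf P \<times> set_pmf (g n)"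
    unfolding Q(2,3)[symmetric] by force
  then have "finite (set_pmf Q)"
    using P(1) fin_gn by (auto intro: finite_subset)
  then have "finite (set_pmf R)"
    by (simp add: R_def)
  moreover have "map_pmf (\<lambda>w. w i) R = \<mu> i" if "i \<le> Suc n" for i
  proof (cases "i = Suc n")
    case True
    have "map_pmf (\<lambda>w. w i) R = map_pmf snd (map_pmf snd Q)"
      unfolding R_def pmf.map_comp using True by (intro map_pmf_cong) auto
    then show ?thesis using Q Suc.prems(3)[of n] True by simp
  next
    case False
    have "map_pmf (\<lambda>w. w i) R = map_pmf (\<lambda>w. w i) (map_pmf fst Q)"
      unfolding R_def pmf.map_comp using False by (intro map_pmf_cong) auto
    then show ?thesis using Q P(2)[of i] that False by simp
  qed
  moreover have "map_pmf (\<lambda>w. (w i, w (Suc i))) R = g i" if "i < Suc n" for i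
  proof (cases "i = n")
    case True
    \<comment> \<open>On the support of \<open>Q\<close> the endpoint \<open>w n\<close> is
      \<open>fst q\<close>, so the new last step of the path is exactly \<open>q\<close>.\<close>
    have "map_pmf (\<lambda>w. (w i, w (Suc i))) R = map_pmf snd Q"
      unfolding R_def pmf.map_comp using True Q(1) by (intro map_pmf_cong) auto
    then show ?thesis using Q True by simp
  next
    case False
    have "map_pmf (\<lambda>w. (w i, w (Suc i))) R = map_pmf (\<lambda>w. (w i, w (Suc i))) (map_pmf fst Q)"
      unfolding R_def pmf.map_comp using False that by (intro map_pmf_cong) auto
    then show ?thesis using Q P(3)[of i] that False by simp
  qed
  ultimately show ?case by blast
qed

section \<open>Existence of optimal plans\<close>

lemma embed_pmf_finite:
  fixes f :: "'b \<Rightarrow> real"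
  assumes "finite A" "\<And>x. 0 \<le> f x" "\<And>x. x \<notin> A \<Longrightarrow> f x = 0" "sum f A = 1"
  shows "pmf (embed_pmf f) = f"
proof -
  have "(\<integral>\<^sup>+x. ennreal (f x) \<partial>count_space UNIV) = (\<Sum>x\<in>A. ennreal (f x))"
    using assms by (intro nn_integral_count_space') auto
  also have "\<dots> = 1"
    using assms by (simp add: sum_ennreal)
  finally show ?thesis
    using assms by (intro ext pmf_embed_pmf) auto
qed

text \<open>Tychonoff's theorem for a product of compact factors. Mass functions of plans live in
  such a cube.\<close>

lemma compact_finite_support_cube:
  assumes "finite F"
  shows "compact {h :: 'b \<Rightarrow> real. \<forall>p. h p \<in> (if p \<in> F then {0..1} else {0})}"
proof -
  have "compactin (product_topology (\<lambda>_. euclidean) UNIV)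
      (PiE UNIV (\<lambda>p::'b. if p \<in> F then {0..1::real} else {0}))"
    by (subst compactin_PiE) auto
  moreover have "PiE UNIV (\<lambda>p::'b. if p \<in> F then {0..1::real} else {0})
      = {h. \<forall>p. h p \<in> (if p \<in> F then {0..1} else {0})}"
    by (auto simp: PiE_def Pi_def)
  ultimately show ?thesis
    by (simp add: euclidean_product_topology)
qed

text \<open>Summing over a fixed \<open>F\<close> instead of the varying support makes the cost an
  explicit function of the masses, whose continuity can then be examined.\<close>

lemma plan_cost_eq_sum:
  assumes "0 < \<alpha>" "finite F" "set_pmf g \<subseteq> F"
  shows "plan_cost \<alpha> g = (\<Sum>(x, y)\<in>F. pmf g (x, y) powr \<alpha> * dist x y)"
  unfolding plan_cost_def using assms
  by (intro sum.mono_neutral_left) (auto simp: set_pmf_eq)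

lemma plan_cost_nonneg: "0 \<le> plan_cost \<alpha> g"
  unfolding plan_cost_def by (auto intro!: sum_nonneg)

text \<open>\<open>transport_cost\<close> is a \<open>LEAST\<close> over the reals, so attainment of
  the minimum has to be proved before its value can be used. For positive \<alpha> a continuous
  function is minimized over a compact set.\<close>

lemma optimal_plan_exists:
  fixes a b :: "'a::metric_space pmf"
  assumes "0 \<le> \<alpha>" and fin: "finite (set_pmf a)" "finite (set_pmf b)"
  shows "\<exists>g\<in>transport_plans a b. \<forall>g'\<in>transport_plans a b. plan_cost \<alpha> g \<le> plan_cost \<alpha> g'"
proof (cases "\<alpha> = 0")
  \<comment> \<open>For \<open>\<alpha> = 0\<close> the cost is not continuous in the plan, but depends only on its support.\<close>
  case True
  let ?I = "plan_cost \<alpha> ` transport_plans a b"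
  define c where "c = (\<lambda>S :: ('a \<times> 'a) set. \<Sum>(x, y)\<in>S. dist x y)"
  \<comment> \<open>There is at most one cost value per subset of a finite product, hence only
    finitely many values.\<close>
  have "?I \<subseteq> c ` Pow (set_pmf a \<times> set_pmf b)"
  proof (rule image_subsetI)
    fix g assume g: "g \<in> transport_plans a b"
    have "plan_cost \<alpha> g = c (set_pmf g)"
      unfolding plan_cost_def c_def True by (intro sum.cong) (auto simp: set_pmf_eq)
    then show "plan_cost \<alpha> g \<in> c ` Pow (set_pmf a \<times> set_pmf b)"
      using g by (auto simp: transport_plans_def)
  qed
  moreover have "finite (c ` Pow (set_pmf a \<times> set_pmf b))"
    using fin by (intro finite_imageI) simp
  ultimately have I: "finite ?I"
    by (rule finite_subset)
  have "?I \<noteq> {}"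
    using pair_pmf_transport_plan[OF fin] by auto
  with I have "Min ?I \<in> ?I"
    by (rule Min_in)
  then obtain g where "g \<in> transport_plans a b" "plan_cost \<alpha> g = Min ?I"
    by auto
  moreover have "Min ?I \<le> plan_cost \<alpha> g'" if "g' \<in> transport_plans a b" for g'
    using I that by (intro Min_le) auto
  ultimately show ?thesis by metis
next
  case False
  with assms have \<alpha>: "0 < \<alpha>" by simp
  let ?A = "set_pmf a" and ?B = "set_pmf b"
  let ?F = "?A \<times> ?B"
  have finF: "finite ?F" using fin by simp
  \<comment> \<open>\<open>C\<close> is the compact cube and \<open>D\<close> the closed set of
    marginal constraints; their intersection consists of the mass functions of plans, with pointwise
    convergence.\<close>
  define C where "C = {h :: 'a \<times> 'a \<Rightarrow> real. \<forall>p. h p \<in> (if p \<in> ?F then {0..1} else {0})}"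
  define D where "D = (\<Inter>y\<in>?B. {h :: 'a \<times> 'a \<Rightarrow> real. (\<Sum>x\<in>?A. h (x, y)) = pmf b y})
    \<inter> (\<Inter>x\<in>?A. {h. (\<Sum>y\<in>?B. h (x, y)) = pmf a x})"
  define H where "H = (\<lambda>h :: 'a \<times> 'a \<Rightarrow> real. \<Sum>(x, y)\<in>?F. h (x, y) powr \<alpha> * dist x y)"
  have "closed D"
    unfolding D_def by (intro closed_Int closed_INT ballI closed_Collect_eq continuous_intros)
      auto
  then have comp: "compact (C \<inter> D)"
    using compact_finite_support_cube[OF finF] unfolding C_def by (rule compact_Int_closed[rotated])
  have plan: "pmf g \<in> C \<inter> D" "plan_cost \<alpha> g = H (pmf g)" if "g \<in> transport_plans a b" for g
  proof -
    have "pmf g \<in> C"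
      using that unfolding C_def transport_plans_def by (auto simp: pmf_le_1 set_pmf_eq)
    then show "pmf g \<in> C \<inter> D"
      using that unfolding D_def transport_plans_def by auto
    show "plan_cost \<alpha> g = H (pmf g)"
      using that finF \<alpha> unfolding H_def transport_plans_def by (intro plan_cost_eq_sum) auto
  qed
  have ne: "C \<inter> D \<noteq> {}"
    using plan(1)[OF pair_pmf_transport_plan[OF fin]] by blast
  have "continuous_on (C \<inter> D) H"
  proof -
    have "continuous_on (C \<inter> D) (\<lambda>h. h p powr \<alpha>)" for p
    proof (intro continuous_on_powr' continuous_on_const ballI)
      show "continuous_on (C \<inter> D) (\<lambda>h. h p)"
        by (rule continuous_on_subset[OF continuous_on_product_coordinates]) simp
      \<comment> \<open>Continuity of \<open>powr\<close> at base 0 comes from nonnegative bases,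
        supplied by the cube, and the positive exponent.\<close>
      show "0 \<le> h p \<and> (h p = 0 \<longrightarrow> 0 < \<alpha>)" if "h \<in> C \<inter> D" for h
      proof -
        have "h p \<in> (if p \<in> ?F then {0..1} else {0})"
          using that unfolding C_def by blast
        then show ?thesis
          using \<alpha> by (simp split: if_splits)
      qed
    qed
    then show ?thesis
      unfolding H_def case_prod_unfold by (intro continuous_on_sum continuous_on_mult continuous_on_const) simp
  qed
  from continuous_attains_inf[OF comp ne this]
  obtain h where h: "h \<in> C \<inter> D" "\<And>h'. h' \<in> C \<inter> D \<Longrightarrow> H h \<le> H h'"
    by blast
  \<comment> \<open>The row sums force total mass 1, which lets \<open>embed_pmf\<close> turn the
    minimizer back into a plan.\<close>
  have "sum h ?F = (\<Sum>x\<in>?A. \<Sum>y\<in>?B. h (x, y))"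
    by (simp add: sum.cartesian_product)
  also have "\<dots> = (\<Sum>x\<in>?A. pmf a x)"
    using h(1) by (intro sum.cong) (auto simp: D_def)
  also have "\<dots> = 1"
    using fin by (intro sum_pmf_eq_1) auto
  finally have sum1: "sum h ?F = 1" .
  have h01: "h p \<in> (if p \<in> ?F then {0..1} else {0})" for p
    using h(1) unfolding C_def by blast
  have eq: "pmf (embed_pmf h) = h"
  proof (rule embed_pmf_finite[OF finF _ _ sum1])
    show "0 \<le> h p" for p using h01[of p] by (simp split: if_splits)
    show "h p = 0" if "p \<notin> ?F" for p using h01[of p] that by (simp split: if_splits)
  qed
  have "p \<in> ?F" if "p \<in> set_pmf (embed_pmf h)" for p
    using h01[of p] that by (auto simp: set_pmf_eq eq split: if_splits)
  then have "embed_pmf h \<in> transport_plans a b"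
    using h(1) by (auto simp: transport_plans_def D_def eq)
  then show ?thesis
    using h(2) plan eq by metis
qed

text \<open>Packages the \<open>LEAST\<close> as an attained lower bound, the form in which later
  arguments use the cost.\<close>

lemma transport_cost_optimal:
  fixes a b :: "'a::metric_space pmf"
  assumes "0 \<le> \<alpha>" and fin: "finite (set_pmf a)" "finite (set_pmf b)"
  obtains g where "g \<in> transport_plans a b" "transport_cost \<alpha> a b = plan_cost \<alpha> g"
    "\<And>g'. g' \<in> transport_plans a b \<Longrightarrow> transport_cost \<alpha> a b \<le> plan_cost \<alpha> g'"
proof -
  obtain g where g: "g \<in> transport_plans a b"
    "\<And>g'. g' \<in> transport_plans a b \<Longrightarrow> plan_cost \<alpha> g \<le> plan_cost \<alpha> g'"
    using optimal_plan_exists[OF assms] by blast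
  then have "transport_cost \<alpha> a b = plan_cost \<alpha> g"
    unfolding transport_cost_def by (intro Least_equality) auto
  with g that show ?thesis by metis
qed

section \<open>The cost of a glued plan\<close>

text \<open>Jensen's inequality for a concave power. Young's inequality is applied to each term
  against the mean \<open>c\<close>, and the resulting bounds add up to the total
  \<open>s\<close>.\<close>

lemma sum_powr_le_card:
  fixes t :: "'i \<Rightarrow> real"
  assumes "finite I" "0 \<le> \<alpha>" "\<alpha> < 1" and pos: "\<And>i. i \<in> I \<Longrightarrow> 0 < t i"
  shows "(\<Sum>i\<in>I. t i powr \<alpha>) \<le> real (card I) powr (1 - \<alpha>) * (\<Sum>i\<in>I. t i) powr \<alpha>"
proof (cases "I = {}")
  case False
  define m s c where "m = real (card I)" and "s = (\<Sum>i\<in>I. t i)" and "c = s / m"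
  have m: "0 < m" using False assms(1) by (simp add: m_def card_gt_0_iff)
  have s: "0 < s" unfolding s_def using False assms by (intro sum_pos) auto
  have c: "0 < c" using m s by (simp add: c_def)
  have "(\<Sum>i\<in>I. t i powr \<alpha>) * c powr (1 - \<alpha>) = (\<Sum>i\<in>I. t i powr \<alpha> * c powr (1 - \<alpha>))"
    by (simp add: sum_distrib_right)
  also have "\<dots> \<le> (\<Sum>i\<in>I. \<alpha> * t i + (1 - \<alpha>) * c)"
    using assms c by (intro sum_mono Youngs_inequality_0) auto
  also have "\<dots> = \<alpha> * s + (1 - \<alpha>) * (m * c)"
    by (simp add: sum.distrib sum_distrib_left s_def m_def)
  also have "\<dots> = s"
    using m by (simp add: c_def algebra_simps)
  finally have "(\<Sum>i\<in>I. t i powr \<alpha>) \<le> s / c powr (1 - \<alpha>)"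
    using c by (simp add: pos_le_divide_eq)
  also have "\<dots> = m powr (1 - \<alpha>) * s powr \<alpha>"
  proof -
    have "s = s powr (1 - \<alpha>) * s powr \<alpha>"
      using s by (simp flip: powr_add)
    then show ?thesis
      using m s by (simp add: c_def powr_divide field_simps)
  qed
  finally show ?thesis by (simp add: m_def s_def)
qed simp

text \<open>In the application the two coordinates are the pair of endpoints of a random path and one of
  its steps.\<close>

lemma weighted_sum_le_card_powr:
  fixes q :: "('e \<times> 'f) pmf" and D :: "'f \<Rightarrow> real"
  assumes fin: "finite (set_pmf q)" and \<alpha>: "0 \<le> \<alpha>" "\<alpha> < 1" and D: "\<And>r. 0 \<le> D r"
    and card: "card (fst ` set_pmf q) \<le> M"
  shows "(\<Sum>z\<in>set_pmf q. pmf q z * (pmf (map_pmf fst q) (fst z) powr (\<alpha> - 1) * D (snd z)))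
    \<le> real M powr (1 - \<alpha>) * (\<Sum>r\<in>snd ` set_pmf q. pmf (map_pmf snd q) r powr \<alpha> * D r)"
proof -
  have "(\<Sum>z\<in>set_pmf q. pmf q z * (pmf (map_pmf fst q) (fst z) powr (\<alpha> - 1) * D (snd z)))
    \<le> (\<Sum>z\<in>set_pmf q. pmf q z powr \<alpha> * D (snd z))"
  proof (rule sum_mono)
    fix z assume "z \<in> set_pmf q"
    then have pos: "0 < pmf q z" by (simp add: pmf_positive)
    \<comment> \<open>A pair carries no more mass than its first coordinate; the negative exponent
      \<alpha> - 1 reverses the inequality.\<close>
    have "pmf q z \<le> pmf (map_pmf fst q) (fst z)"
      using fin \<open>z \<in> set_pmf q\<close> by (subst pmf_map_finite) (auto intro!: member_le_sum)
    then have "pmf (map_pmf fst q) (fst z) powr (\<alpha> - 1) \<le> pmf q z powr (\<alpha> - 1)"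
      using \<alpha> pos by (intro powr_mono2') auto
    then have "pmf q z * pmf (map_pmf fst q) (fst z) powr (\<alpha> - 1)
        \<le> pmf q z * pmf q z powr (\<alpha> - 1)"
      using pos by simp
    also have "\<dots> = pmf q z powr \<alpha>"
      using pos by (simp add: powr_mult_base)
    finally have "pmf q z * pmf (map_pmf fst q) (fst z) powr (\<alpha> - 1) * D (snd z)
        \<le> pmf q z powr \<alpha> * D (snd z)"
      using D by (intro mult_right_mono)
    then show "pmf q z * (pmf (map_pmf fst q) (fst z) powr (\<alpha> - 1) * D (snd z))
        \<le> pmf q z powr \<alpha> * D (snd z)"
      by (simp add: mult.assoc)
  qed
  \<comment> \<open>Grouping by the second coordinate makes \<open>D\<close> constant on each group,
    so concavity can be applied to the masses alone.\<close>
  also have "\<dots> = (\<Sum>r\<in>snd ` set_pmf q. \<Sum>z | z \<in> set_pmf q \<and> snd z = r. pmf q z powr \<alpha> * D (snd z))"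
    using fin by (rule sum.image_gen)
  also have "\<dots> \<le> (\<Sum>r\<in>snd ` set_pmf q. real M powr (1 - \<alpha>) * (pmf (map_pmf snd q) r powr \<alpha> * D r))"
  proof (rule sum_mono)
    fix r assume "r \<in> snd ` set_pmf q"
    let ?I = "{z. z \<in> set_pmf q \<and> snd z = r}"
    \<comment> \<open>With the second coordinate fixed, a pair is determined by its first, so each
      group has at most \<open>M\<close> members.\<close>
    have "card ?I = card (fst ` ?I)"
      by (intro card_image[symmetric]) (auto simp: inj_on_def)
    also have "\<dots> \<le> card (fst ` set_pmf q)"
      using fin by (intro card_mono) auto
    finally have I: "card ?I \<le> M" using card by simp
    have "(\<Sum>z\<in>?I. pmf q z powr \<alpha>) \<le> real (card ?I) powr (1 - \<alpha>) * (\<Sum>z\<in>?I. pmf q z) powr \<alpha>"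
      using fin \<alpha> by (intro sum_powr_le_card) (auto simp: pmf_positive)
    also have "\<dots> \<le> real M powr (1 - \<alpha>) * (\<Sum>z\<in>?I. pmf q z) powr \<alpha>"
      using I \<alpha> by (intro mult_right_mono powr_mono2) auto
    also have "(\<Sum>z\<in>?I. pmf q z) = pmf (map_pmf snd q) r"
      using fin by (simp add: pmf_map_finite)
    finally have "(\<Sum>z\<in>?I. pmf q z powr \<alpha>) * D r
        \<le> real M powr (1 - \<alpha>) * pmf (map_pmf snd q) r powr \<alpha> * D r"
      using D by (intro mult_right_mono)
    then show "(\<Sum>z\<in>?I. pmf q z powr \<alpha> * D (snd z))
        \<le> real M powr (1 - \<alpha>) * (pmf (map_pmf snd q) r powr \<alpha> * D r)"
      by (simp add: sum_distrib_right mult.assoc)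
  qed
  finally show ?thesis
    by (simp add: sum_distrib_left)
qed

lemma dist_path_le:
  fixes w :: "nat \<Rightarrow> 'a::metric_space"
  shows "dist (w 0) (w n) \<le> (\<Sum>i<n. dist (w i) (w (Suc i)))"
proof (induction n)
  case (Suc n)
  then show ?case
    using dist_triangle[of "w 0" "w (Suc n)" "w n"] by simp
qed simp

lemma plan_cost_endpoints_le:
  fixes P :: "(nat \<Rightarrow> 'a::metric_space) pmf"
  assumes fin: "finite (set_pmf P)" and \<alpha>: "0 \<le> \<alpha>" "\<alpha> < 1"
    and card: "card ((\<lambda>w. (w 0, w n)) ` set_pmf P) \<le> M"
  shows "plan_cost \<alpha> (map_pmf (\<lambda>w. (w 0, w n)) P)
    \<le> real M powr (1 - \<alpha>) * (\<Sum>i<n. plan_cost \<alpha> (map_pmf (\<lambda>w. (w i, w (Suc i))) P))"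
proof -
  define e where "e = (\<lambda>w :: nat \<Rightarrow> 'a. (w 0, w n))"
  define f where "f i = (\<lambda>w :: nat \<Rightarrow> 'a. (w i, w (Suc i)))" for i
  define d where "d = (\<lambda>p :: 'a \<times> 'a. dist (fst p) (snd p))"
  define g where "g = map_pmf e P"
  \<comment> \<open>Splitting off one factor of mass turns the cost into an expectation, which can
    be pulled back to a sum over paths.\<close>
  have "plan_cost \<alpha> g = (\<Sum>p\<in>set_pmf g. pmf g p * (pmf g p powr (\<alpha> - 1) * d p))"
    unfolding plan_cost_def
    by (intro sum.cong refl)
       (auto simp: case_prod_unfold d_def pmf_positive powr_mult_base simp flip: mult.assoc)
  also have "\<dots> = (\<Sum>w\<in>set_pmf P. pmf P w * (pmf g (e w) powr (\<alpha> - 1) * d (e w)))"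
    unfolding g_def by (rule sum_map_pmf[OF fin])
  also have "\<dots> \<le> (\<Sum>w\<in>set_pmf P. pmf P w * (pmf g (e w) powr (\<alpha> - 1) * (\<Sum>i<n. d (f i w))))"
    by (intro sum_mono mult_left_mono) (auto simp: d_def e_def f_def dist_path_le)
  also have "\<dots> = (\<Sum>i<n. \<Sum>w\<in>set_pmf P. pmf P w * (pmf g (e w) powr (\<alpha> - 1) * d (f i w)))"
    unfolding sum_distrib_left by (rule sum.swap)
  also have "\<dots> \<le> (\<Sum>i<n. real M powr (1 - \<alpha>) * plan_cost \<alpha> (map_pmf (f i) P))"
  proof (rule sum_mono)
    fix i
    \<comment> \<open>The joint law of the endpoints and the \<open>i\<close>-th step, with
      marginals \<open>g\<close> and the law of that step.\<close>
    define q where "q = map_pmf (\<lambda>w. (e w, f i w)) P"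
    have q: "map_pmf fst q = g" "map_pmf snd q = map_pmf (f i) P" "finite (set_pmf q)"
      using fin by (auto simp: q_def g_def pmf.map_comp o_def)
    have "(\<Sum>w\<in>set_pmf P. pmf P w * (pmf g (e w) powr (\<alpha> - 1) * d (f i w)))
      = (\<Sum>z\<in>set_pmf q. pmf q z * (pmf g (fst z) powr (\<alpha> - 1) * d (snd z)))"
      unfolding q_def by (subst sum_map_pmf[OF fin]) simp
    also have "\<dots> \<le> real M powr (1 - \<alpha>)
        * (\<Sum>r\<in>snd ` set_pmf q. pmf (map_pmf snd q) r powr \<alpha> * d r)"
      unfolding q(1)[symmetric] using q(3) \<alpha> card
      by (intro weighted_sum_le_card_powr) (auto simp: q_def d_def e_def image_image)
    also have "snd ` set_pmf q = set_pmf (map_pmf (f i) P)"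
      using q(2) by (metis pmf.set_map)
    finally show "(\<Sum>w\<in>set_pmf P. pmf P w * (pmf g (e w) powr (\<alpha> - 1) * d (f i w)))
      \<le> real M powr (1 - \<alpha>) * plan_cost \<alpha> (map_pmf (f i) P)"
      unfolding plan_cost_def q(2) d_def by (simp add: case_prod_unfold)
  qed
  finally show ?thesis
    by (simp add: g_def e_def f_def sum_distrib_left)
qed

text \<open>Gluing all plans at once, rather than iterating a relaxed triangle inequality, keeps the
  constant independent of \<open>n\<close>. The case of two steps gives the quasimetric
  axiom.\<close>

lemma transport_cost_chain:
  fixes \<mu> :: "nat \<Rightarrow> 'a::metric_space pmf"
  assumes \<alpha>: "0 \<le> \<alpha>" "\<alpha> < 1" and \<mu>: "\<And>i. i \<le> n \<Longrightarrow> \<mu> i \<in> atomic_measures N"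
  shows "transport_cost \<alpha> (\<mu> 0) (\<mu> n)
    \<le> real N powr (2 * (1 - \<alpha>)) * (\<Sum>i<n. transport_cost \<alpha> (\<mu> i) (\<mu> (Suc i)))"
proof -
  have fin: "finite (set_pmf (\<mu> i))" if "i \<le> n" for i
    using \<mu>[OF that] by (simp add: atomic_measures_def)
  have "\<exists>g. g \<in> transport_plans (\<mu> i) (\<mu> (Suc i))
      \<and> transport_cost \<alpha> (\<mu> i) (\<mu> (Suc i)) = plan_cost \<alpha> g" if "i < n" for i
    using that transport_cost_optimal[OF \<alpha>(1) fin fin, of i "Suc i"]
    by (metis Suc_leI less_imp_le)
  then obtain g where g: "\<And>i. i < n \<Longrightarrow> g i \<in> transport_plans (\<mu> i) (\<mu> (Suc i))"
    "\<And>i. i < n \<Longrightarrow> transport_cost \<alpha> (\<mu> i) (\<mu> (Suc i)) = plan_cost \<alpha> (g i)"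
    by metis
  have marg: "map_pmf fst (g i) = \<mu> i \<and> map_pmf snd (g i) = \<mu> (Suc i)" if "i < n" for i
    using g(1)[OF that] that by (subst (asm) transport_plans_iff) (auto intro: fin)
  obtain P :: "(nat \<Rightarrow> 'a) pmf" where P: "finite (set_pmf P)"
    "\<And>i. i \<le> n \<Longrightarrow> map_pmf (\<lambda>w. w i) P = \<mu> i"
    "\<And>i. i < n \<Longrightarrow> map_pmf (\<lambda>w. (w i, w (Suc i))) P = g i"
    using glue_transport_plans[of n \<mu> g, OF fin conjunct1[OF marg] conjunct2[OF marg]] by blast
  let ?g = "map_pmf (\<lambda>w. (w 0, w n)) P"
  have plan: "?g \<in> transport_plans (\<mu> 0) (\<mu> n)"
    using P(2)[of 0] P(2)[of n] by (subst transport_plans_iff) (auto intro: fin simp: pmf.map_comp o_def)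
  \<comment> \<open>Both end measures have at most \<open>N\<close> atoms; the square
    \<open>N * N\<close> is the source of the 2 in the exponent.\<close>
  have "card (set_pmf ?g) \<le> card (set_pmf (\<mu> 0) \<times> set_pmf (\<mu> n))"
    using plan by (intro card_mono) (auto intro: fin simp: transport_plans_def)
  also have "\<dots> \<le> N * N"
    using \<mu>[of 0] \<mu>[of n] by (auto simp: card_cartesian_product atomic_measures_def intro: mult_le_mono)
  finally have card: "card ((\<lambda>w. (w 0, w n)) ` set_pmf P) \<le> N * N"
    by simp
  have "transport_cost \<alpha> (\<mu> 0) (\<mu> n) \<le> plan_cost \<alpha> ?g"
    using transport_cost_optimal[OF \<alpha>(1) fin fin, of 0 n] plan by (metis le0 order_refl)
  also have "\<dots> \<le> real (N * N) powr (1 - \<alpha>)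
      * (\<Sum>i<n. plan_cost \<alpha> (map_pmf (\<lambda>w. (w i, w (Suc i))) P))"
    by (rule plan_cost_endpoints_le[OF P(1) \<alpha> card])
  also have "(\<Sum>i<n. plan_cost \<alpha> (map_pmf (\<lambda>w. (w i, w (Suc i))) P))
      = (\<Sum>i<n. transport_cost \<alpha> (\<mu> i) (\<mu> (Suc i)))"
    using P(3) g(2) by (intro sum.cong) auto
  also have "real (N * N) powr (1 - \<alpha>) = real N powr (2 * (1 - \<alpha>))"
    by (simp add: powr_mult flip: powr_add)
  finally show ?thesis .
qed

section \<open>The quasimetric axioms\<close>

lemma transport_cost_nonneg:
  assumes "0 \<le> \<alpha>" "finite (set_pmf a)" "finite (set_pmf b)"
  shows "0 \<le> transport_cost \<alpha> a b"
  using transport_cost_optimal[OF assms] plan_cost_nonneg by metis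

text \<open>Zero cost puts all mass of an optimal plan on the diagonal, so its marginals agree.
  Conversely the diagonal plan costs nothing.\<close>

lemma transport_cost_eq_0_iff:
  assumes "0 \<le> \<alpha>" and fin: "finite (set_pmf a)" "finite (set_pmf b)"
  shows "transport_cost \<alpha> a b = 0 \<longleftrightarrow> a = b"
proof
  assume "transport_cost \<alpha> a b = 0"
  then obtain g where g: "g \<in> transport_plans a b" "plan_cost \<alpha> g = 0"
    using transport_cost_optimal[OF assms] by metis
  have "finite (set_pmf g)"
    using finite_set_transport_plan[OF g(1) fin] .
  with g(2) have "\<forall>p\<in>set_pmf g. pmf g p powr \<alpha> * dist (fst p) (snd p) = 0"
    unfolding plan_cost_def case_prod_unfold by (subst (asm) sum_nonneg_eq_0_iff) auto
  then have "fst p = snd p" if "p \<in> set_pmf g" for p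
    using that by (auto simp: set_pmf_eq)
  then have "map_pmf fst g = map_pmf snd g"
    by (intro map_pmf_cong) auto
  then show "a = b"
    using g(1) transport_plans_iff[OF fin] by metis
next
  assume "a = b"
  let ?g = "map_pmf (\<lambda>x. (x, x)) a"
  have "?g \<in> transport_plans a b"
    using fin \<open>a = b\<close> by (subst transport_plans_iff) (auto simp: pmf.map_comp o_def)
  moreover have "plan_cost \<alpha> ?g = 0"
    unfolding plan_cost_def by (intro sum.neutral) auto
  ultimately have "transport_cost \<alpha> a b \<le> 0"
    using transport_cost_optimal[OF assms] by metis
  with transport_cost_nonneg[OF assms] show "transport_cost \<alpha> a b = 0"
    by simp
qed

lemma plan_cost_swap: "plan_cost \<alpha> (map_pmf prod.swap g) = plan_cost \<alpha> g"
proof -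
  have "pmf (map_pmf prod.swap g) (prod.swap p) = pmf g p" for p
    by (rule pmf_map_inj') (rule inj_swap)
  then show ?thesis
    unfolding plan_cost_def case_prod_unfold
    by (simp add: sum.reindex inj_swap dist_commute)
qed

text \<open>Reversing an optimal plan preserves its cost; symmetry follows by exchanging the roles
  of \<open>a\<close> and \<open>b\<close>.\<close>

lemma transport_cost_le_swap:
  assumes "0 \<le> \<alpha>" and fin: "finite (set_pmf a)" "finite (set_pmf b)"
  shows "transport_cost \<alpha> a b \<le> transport_cost \<alpha> b a"
proof -
  obtain g where g: "g \<in> transport_plans b a" "transport_cost \<alpha> b a = plan_cost \<alpha> g"
    using transport_cost_optimal[OF assms(1) fin(2,1)] by metis
  have "map_pmf prod.swap g \<in> transport_plans a b"
    using g(1) fin by (simp add: transport_plans_iff pmf.map_comp o_def)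
  then show ?thesis
    using g(2) plan_cost_swap transport_cost_optimal[OF assms] by metis
qed

lemma quasimetric_on_transport_cost:
  assumes \<alpha>: "0 \<le> \<alpha>" "\<alpha> < 1" and "1 \<le> N"
  shows "quasimetric_on (atomic_measures N :: 'a::metric_space pmf set) (transport_cost \<alpha>)"
  unfolding quasimetric_on_def
proof (intro conjI ballI)
  have "return_pmf undefined \<in> (atomic_measures N :: 'a pmf set)"
    using assms(3) by (simp add: atomic_measures_def)
  then show "(atomic_measures N :: 'a pmf set) \<noteq> {}" by blast
next
  fix a b :: "'a pmf" assume ab: "a \<in> atomic_measures N" "b \<in> atomic_measures N"
  then have fin: "finite (set_pmf a)" "finite (set_pmf b)"
    by (auto simp: atomic_measures_def)
  show "0 \<le> transport_cost \<alpha> a b" "transport_cost \<alpha> a b = 0 \<longleftrightarrow> a = b"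
    "transport_cost \<alpha> a b = transport_cost \<alpha> b a"
    using transport_cost_nonneg transport_cost_eq_0_iff transport_cost_le_swap fin \<alpha>(1)
    by (blast intro: antisym)+
next
  let ?K = "real N powr (2 * (1 - \<alpha>))"
  have "transport_cost \<alpha> a b \<le> ?K * (transport_cost \<alpha> a c + transport_cost \<alpha> c b)"
    if "a \<in> atomic_measures N" "b \<in> atomic_measures N" "c \<in> atomic_measures N"
    for a b c :: "'a pmf"
    \<comment> \<open>The two-step chain through the intermediate measure \<open>c\<close>.\<close>
    using transport_cost_chain[OF \<alpha>, of 2 "\<lambda>i. [a, c, b] ! i" N] that
    by (simp add: nth_Cons' numeral_2_eq_2 lessThan_Suc add.commute)
  moreover have "1 \<le> ?K"
    using assms by (intro ge_one_powr_ge_zero) auto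
  ultimately show "\<exists>\<sigma>\<ge>1. \<forall>a\<in>atomic_measures N. \<forall>b\<in>atomic_measures N. \<forall>c\<in>atomic_measures N.
      transport_cost \<alpha> a b \<le> \<sigma> * (transport_cost \<alpha> a c + transport_cost \<alpha> c (b :: 'a pmf))"
    by blast
qed

section \<open>The constants of a quasimetric\<close>

text \<open>The predicate under \<open>LEAST\<close> in \<open>sigma_const\<close>, named so that
  its set of solutions can be studied.\<close>

definition chain_bound :: "'b set \<Rightarrow> ('b \<Rightarrow> 'b \<Rightarrow> real) \<Rightarrow> nat \<Rightarrow> real \<Rightarrow> bool" where
  "chain_bound X J n \<sigma> \<longleftrightarrow> 1 \<le> \<sigma> \<and>
     (\<forall>x::nat \<Rightarrow> 'b. (\<forall>i\<in>{1..n+1}. x i \<in> X) \<longrightarrow>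
        J (x 1) (x (n+1)) \<le> \<sigma> * (\<Sum>i=1..n. J (x i) (x (i+1))))"

text \<open>The admissible constants form an intersection of closed sets, bounded below by 1 and
  containing \<open>K\<close>, so the infimum is itself admissible and is what \<open>LEAST\<close>
  denotes.\<close>

lemma sigma_const_least:
  assumes "chain_bound X J n K"
  shows "chain_bound X J n (sigma_const X J n)" "sigma_const X J n \<le> K"
proof -
  let ?S = "{\<sigma>. chain_bound X J n \<sigma>}"
  have "?S = {1..} \<inter> (\<Inter>x\<in>{x. \<forall>i\<in>{1..n+1}. x i \<in> X}.
      {\<sigma>. J (x 1) (x (n+1)) \<le> \<sigma> * (\<Sum>i=1..n. J (x i) (x (i+1)))})"
    by (auto simp: chain_bound_def)
  then have "closed ?S"
    by (simp only:) (intro closed_Int closed_INT ballI closed_Collect_le continuous_intros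
        closed_atLeast)
  moreover have "bdd_below ?S"
    by (rule bdd_belowI[of _ 1]) (simp add: chain_bound_def)
  moreover have "?S \<noteq> {}"
    using assms by blast
  ultimately have Inf: "Inf ?S \<in> ?S"
    by (intro closed_contains_Inf)
  have le: "Inf ?S \<le> \<sigma>" if "chain_bound X J n \<sigma>" for \<sigma>
    using that \<open>bdd_below ?S\<close> by (simp add: cInf_lower)
  have "sigma_const X J n = (LEAST \<sigma>. chain_bound X J n \<sigma>)"
    by (simp add: sigma_const_def chain_bound_def)
  also have "\<dots> = Inf ?S"
    using Inf le by (intro Least_equality) auto
  finally show "chain_bound X J n (sigma_const X J n)" "sigma_const X J n \<le> K"
    using Inf le assms by auto
qed

text \<open>A chain is lengthened by repeating its last point, which adds a zero term. This makes
  the constants nondecreasing in \<open>n\<close>.\<close>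

lemma chain_bound_Suc_imp:
  assumes "\<And>y. y \<in> X \<Longrightarrow> J y y = 0" "chain_bound X J (Suc n) \<sigma>"
  shows "chain_bound X J n \<sigma>"
  unfolding chain_bound_def
proof (intro conjI allI impI)
  show "1 \<le> \<sigma>" using assms by (simp add: chain_bound_def)
next
  fix x :: "nat \<Rightarrow> 'a" assume x: "\<forall>i\<in>{1..n+1}. x i \<in> X"
  define y where "y = (\<lambda>i. x (min i (n + 1)))"
  have "\<forall>i\<in>{1..Suc n+1}. y i \<in> X"
    using x by (auto simp: y_def)
  then have "J (y 1) (y (Suc n + 1)) \<le> \<sigma> * (\<Sum>i=1..Suc n. J (y i) (y (i+1)))"
    using assms(2) by (simp add: chain_bound_def)
  moreover have "(\<Sum>i=1..n. J (y i) (y (i+1))) = (\<Sum>i=1..n. J (x i) (x (i+1)))"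
    by (intro sum.cong) (auto simp: y_def)
  moreover have "J (y (Suc n)) (y (Suc n + 1)) = 0"
    using x assms(1) by (simp add: y_def)
  ultimately show "J (x 1) (x (n+1)) \<le> \<sigma> * (\<Sum>i=1..n. J (x i) (x (i+1)))"
    by (simp add: y_def)
qed

lemma sigma_infinity_le:
  assumes "\<And>y. y \<in> X \<Longrightarrow> J y y = 0" and K: "\<And>n. chain_bound X J n K"
  shows "sigma_infinity X J \<le> ereal K"
proof -
  \<comment> \<open>Monotonicity gives convergence in \<open>ereal\<close>, identifying
    \<open>lim\<close> with a supremum.\<close>
  have "sigma_const X J n \<le> sigma_const X J (Suc n)" for n
    using chain_bound_Suc_imp[OF assms(1) sigma_const_least(1)[OF K]]
    by (rule sigma_const_least(2))
  then have "incseq (\<lambda>n. ereal (sigma_const X J n))"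
    by (intro incseq_SucI) simp
  then have "sigma_infinity X J = (SUP n. ereal (sigma_const X J n))"
    unfolding sigma_infinity_def by (intro limI LIMSEQ_SUP)
  also have "\<dots> \<le> ereal K"
    using sigma_const_least(2)[OF K] by (intro SUP_least) simp
  finally show ?thesis .
qed

lemma chain_bound_transport_cost:
  assumes \<alpha>: "0 \<le> \<alpha>" "\<alpha> < 1" and "1 \<le> N"
  shows "chain_bound (atomic_measures N :: 'a::metric_space pmf set) (transport_cost \<alpha>) n
    (real N powr (2 * (1 - \<alpha>)))"
  unfolding chain_bound_def
proof (intro conjI allI impI)
  show "1 \<le> real N powr (2 * (1 - \<alpha>))"
    using assms by (intro ge_one_powr_ge_zero) auto
next
  fix x :: "nat \<Rightarrow> 'a pmf" assume "\<forall>i\<in>{1..n+1}. x i \<in> atomic_measures N"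
  \<comment> \<open>Chains in \<open>sigma_const\<close> are numbered from 1, those in
    \<open>transport_cost_chain\<close> from 0; hence the shift.\<close>
  then have "transport_cost \<alpha> (x (Suc 0)) (x (Suc n)) \<le> real N powr (2 * (1 - \<alpha>))
      * (\<Sum>i<n. transport_cost \<alpha> (x (Suc i)) (x (Suc (Suc i))))"
    by (intro transport_cost_chain[OF \<alpha>, of n "\<lambda>i. x (Suc i)"]) auto
  also have "(\<Sum>i<n. transport_cost \<alpha> (x (Suc i)) (x (Suc (Suc i))))
      = (\<Sum>i=1..n. transport_cost \<alpha> (x i) (x (i + 1)))"
    by (simp add: sum.atLeast1_atMost_eq)
  finally show "transport_cost \<alpha> (x 1) (x (n+1)) \<le> real N powr (2 * (1 - \<alpha>))
      * (\<Sum>i=1..n. transport_cost \<alpha> (x i) (x (i+1)))"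
    by simp
qed

theorem theorem4p14:
  fixes \<alpha> :: real and N :: nat
  assumes "0 \<le> \<alpha>" and "\<alpha> < 1" and "1 \<le> N"
  shows "ideal_quasimetric_on (atomic_measures N :: 'a::metric_space pmf set) (transport_cost \<alpha>) \<and>
    sigma_infinity (atomic_measures N :: 'a pmf set) (transport_cost \<alpha>)
      \<le> ereal (real N powr (2 * (1 - \<alpha>)))"
proof -
  have q: "quasimetric_on (atomic_measures N :: 'a pmf set) (transport_cost \<alpha>)"
    by (rule quasimetric_on_transport_cost[OF assms])
  have "sigma_infinity (atomic_measures N :: 'a pmf set) (transport_cost \<alpha>)
      \<le> ereal (real N powr (2 * (1 - \<alpha>)))"
    using q by (intro sigma_infinity_le chain_bound_transport_cost[OF assms])
      (auto simp: quasimetric_on_def)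
  moreover from this have "sigma_infinity (atomic_measures N :: 'a pmf set) (transport_cost \<alpha>) < \<infinity>"
    by (rule le_less_trans) simp
  ultimately show ?thesis
    using q by (simp add: ideal_quasimetric_on_def)
qed

end
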